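(* Let $Z\in\mathbb{R}^{N\times N}$ and let $K\in[1,N]$ be an integer. Suppose that $X^*\in\mathbb{R}^{N\times K}$ is a KKT point of the problem $\min_{X\in\mathbb{R}^{N\times K},\,X\ge0}\ f(X)=\frac12\|XX^T-Z\|_F^2$. Then $X^*$ is also a global optimal point of this problem if $$S:=X^*(X^* )^T-\frac{Z^T+Z}{2}\succeq0 .$$
   Context: $\|\cdot\|_F$ is the Frobenius norm, $X\ge0$ is entrywise, and $\succeq0$ means positive semidefinite. $Z$ is not assumed symmetric, positive semidefinite, or nonnegative. $X^*$ is a KKT point of the problem if there is $\Omega^*\in\mathbb{R}^{N\times K}$ with $2\big(X^*(X^* )^T-\frac{Z^T+Z}{2}\big)X^*-\Omega^*=0$, $\Omega^*\ge0$, $X^*\ge0$, $X^*\circ\Omega^*=0$ ($\circ$ = entrywise product). *)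

theory Defs
  imports "HOL-Analysis.Analysis"
begin

text \<open>
  A matrix with \<open>N = CARD('n)\<close> rows and \<open>K = CARD('k)\<close> columns has type \<open>real ^ 'k ^ 'n\<close>.
  On this type the library's \<open>norm\<close> is the Frobenius norm, and \<open>\<le>\<close> and \<open>*\<close> are entrywise
  (the matrix product is \<open>**\<close>):
\<close>

lemma norm_matrix_eq_frobenius:
  fixes A :: "real ^ 'k ^ 'n"
  shows "norm A = sqrt (\<Sum>i\<in>UNIV. \<Sum>j\<in>UNIV. (A $ i $ j)\<^sup>2)"
  by (simp add: norm_vec_def L2_set_def sum_nonneg)

lemma nonneg_matrix_iff:
  fixes A :: "real ^ 'k ^ 'n"
  shows "0 \<le> A \<longleftrightarrow> (\<forall>i j. 0 \<le> A $ i $ j)"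
  by (simp add: less_eq_vec_def)

lemma times_matrix_entry:
  fixes A B :: "real ^ 'k ^ 'n"
  shows "(A * B) $ i $ j = A $ i $ j * B $ i $ j"
  by simp

definition pos_semidef :: "real ^ 'n ^ 'n \<Rightarrow> bool" where
  "pos_semidef A \<longleftrightarrow> transpose A = A \<and> (\<forall>x. 0 \<le> x \<bullet> (A *v x))"

definition snmf_objective :: "real ^ 'n ^ 'n \<Rightarrow> real ^ 'k ^ 'n \<Rightarrow> real" where
  "snmf_objective Z X = 1 / 2 * (norm (X ** transpose X - Z))\<^sup>2"

definition snmf_KKT_point :: "real ^ 'n ^ 'n \<Rightarrow> real ^ 'k ^ 'n \<Rightarrow> bool" where
  "snmf_KKT_point Z X \<longleftrightarrow>
    (\<exists>\<Omega> :: real ^ 'k ^ 'n.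
      2 *\<^sub>R ((X ** transpose X - (1 / 2) *\<^sub>R (transpose Z + Z)) ** X) - \<Omega> = 0 \<and>
      0 \<le> \<Omega> \<and> 0 \<le> X \<and> X * \<Omega> = 0)"

definition snmf_global_optimum :: "real ^ 'n ^ 'n \<Rightarrow> real ^ 'k ^ 'n \<Rightarrow> bool" where
  "snmf_global_optimum Z X \<longleftrightarrow> is_arg_min (snmf_objective Z) (\<lambda>Y. 0 \<le> Y) X"

end

theory Submission
  imports Defs
begin

text \<open>
  Write \<open>D = Y Y\<^sup>T - X X\<^sup>T\<close> for a competitor \<open>Y\<close>. Expanding the square gives
  \<open>f Y - f X = \<langle>D, X X\<^sup>T - Z\<rangle> + \<parallel>D\<parallel>\<^sup>2 / 2\<close>. As \<open>D\<close> is symmetric, only the symmetric part \<open>S\<close> of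
  \<open>X X\<^sup>T - Z\<close> contributes, so the linear term equals \<open>\<langle>Y, S Y\<rangle> - \<langle>X, S X\<rangle>\<close>. The first summand is
  nonnegative since \<open>S\<close> is positive semidefinite, and the second vanishes by complementarity.
\<close>

lemma matrix_inner_eq_sum:
  fixes A B :: "real ^ 'k ^ 'n"
  shows "A \<bullet> B = (\<Sum>i\<in>UNIV. \<Sum>j\<in>UNIV. A $ i $ j * B $ i $ j)"
  by (simp add: inner_vec_def)

lemma inner_transpose_transpose:
  fixes A B :: "real ^ 'k ^ 'n"
  shows "transpose A \<bullet> transpose B = A \<bullet> B"
  unfolding matrix_inner_eq_sum transpose_def
  by (simp, rule sum.swap)

lemma matrix_inner_eq_sum_columns:
  fixes A B :: "real ^ 'k ^ 'n"
  shows "A \<bullet> B = (\<Sum>j\<in>UNIV. column j A \<bullet> column j B)"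
  \<comment> \<open>The inner product of the type sums over rows; transposing both arguments turns
    columns into rows.\<close>
  unfolding inner_transpose_transpose[of A B, symmetric]
  by (simp add: inner_vec_def transpose_def column_def)

lemma column_matrix_mult:
  fixes A :: "real ^ 'm ^ 'n" and B :: "real ^ 'k ^ 'm"
  shows "column j (A ** B) = A *v column j B"
  by (simp add: column_def matrix_matrix_mult_def matrix_vector_mult_def vec_eq_iff)

text \<open>Right multiplication by \<open>transpose B\<close> is adjoint to right multiplication by
  \<open>B\<close>: both sides are one triple sum in different orders.\<close>

lemma inner_matrix_mult_transpose:
  fixes A :: "real ^ 'k ^ 'n" and B :: "real ^ 'k ^ 'm" and C :: "real ^ 'm ^ 'n"
  shows "(A ** transpose B) \<bullet> C = A \<bullet> (C ** B)"
proof -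
  have "(A ** transpose B) \<bullet> C
      = (\<Sum>i\<in>UNIV. \<Sum>j\<in>UNIV. \<Sum>k\<in>UNIV. A $ i $ k * B $ j $ k * C $ i $ j)"
    by (simp add: matrix_inner_eq_sum matrix_matrix_mult_def transpose_def sum_distrib_right)
  also have "\<dots> = (\<Sum>i\<in>UNIV. \<Sum>k\<in>UNIV. \<Sum>j\<in>UNIV. A $ i $ k * B $ j $ k * C $ i $ j)"
    by (intro sum.cong refl sum.swap)
  also have "\<dots> = A \<bullet> (C ** B)"
    by (simp add: matrix_inner_eq_sum matrix_matrix_mult_def sum_distrib_left mult_ac)
  finally show ?thesis .
qed

text \<open>Column by column, the pairing is a sum of values of the quadratic form of
  \<open>S\<close>.\<close>

lemma pos_semidef_inner_matrix_mult_nonneg: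
  fixes Y :: "real ^ 'k ^ 'n"
  assumes "pos_semidef S"
  shows "0 \<le> Y \<bullet> (S ** Y)"
  using assms unfolding matrix_inner_eq_sum_columns column_matrix_mult pos_semidef_def
  by (simp add: sum_nonneg)

lemma transpose_diff:
  fixes A B :: "real ^ 'k ^ 'n"
  shows "transpose (A - B) = transpose A - transpose B"
  by (simp add: transpose_def vec_eq_iff)

text \<open>Transposing both factors preserves the inner product, so a symmetric \<open>D\<close>
  pairs equally with \<open>Z\<close> and \<open>transpose Z\<close>.\<close>

lemma inner_symmetric_part:
  fixes D Z :: "real ^ 'n ^ 'n"
  assumes "transpose D = D"
  shows "D \<bullet> ((1 / 2) *\<^sub>R (transpose Z + Z)) = D \<bullet> Z"
  using inner_transpose_transpose[of D Z] assms by (simp add: inner_add_right)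

text \<open>Stationarity makes the second factor half the multiplier \<Omega>, and complementarity
  kills each term of its pairing with \<open>X\<close>.\<close>

lemma snmf_KKT_point_inner_eq_0:
  fixes X :: "real ^ 'k ^ 'n"
  assumes "snmf_KKT_point Z X"
  shows "X \<bullet> ((X ** transpose X - (1 / 2) *\<^sub>R (transpose Z + Z)) ** X) = 0"
proof -
  obtain \<Omega> where \<Omega>: "2 *\<^sub>R ((X ** transpose X - (1 / 2) *\<^sub>R (transpose Z + Z)) ** X) = \<Omega>"
    and compl: "X * \<Omega> = 0"
    using assms unfolding snmf_KKT_point_def by auto
  have "X $ i $ j * \<Omega> $ i $ j = 0" for i j
    using compl times_matrix_entry[of X \<Omega> i j] by simp
  then have "X \<bullet> \<Omega> = 0"
    by (simp only: matrix_inner_eq_sum sum.neutral_const)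
  then show ?thesis
    unfolding \<Omega>[symmetric] by simp
qed

text \<open>The expansion is exact because the objective is quadratic in
  \<open>Y ** transpose Y\<close>.\<close>

lemma snmf_objective_diff:
  fixes Z :: "real ^ 'n ^ 'n" and X Y :: "real ^ 'k ^ 'n"
  defines "S \<equiv> X ** transpose X - (1 / 2) *\<^sub>R (transpose Z + Z)"
  shows "snmf_objective Z Y - snmf_objective Z X
    = Y \<bullet> (S ** Y) - X \<bullet> (S ** X) + (norm (Y ** transpose Y - X ** transpose X))\<^sup>2 / 2"
proof -
  define D where "D = Y ** transpose Y - X ** transpose X"
  have "transpose D = D"
    by (simp add: D_def transpose_diff matrix_transpose_mul)
  then have "D \<bullet> (X ** transpose X - Z) = D \<bullet> S"
    by (simp only: S_def inner_diff_right inner_symmetric_part)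
  \<comment> \<open>By adjointness, each product in \<open>D\<close> moves its transposed factor to
    the side of \<open>S\<close>.\<close>
  also have "\<dots> = Y \<bullet> (S ** Y) - X \<bullet> (S ** X)"
    by (simp add: D_def inner_diff_left inner_matrix_mult_transpose)
  finally have linear: "D \<bullet> (X ** transpose X - Z) = Y \<bullet> (S ** Y) - X \<bullet> (S ** X)" .
  have "Y ** transpose Y - Z = D + (X ** transpose X - Z)"
    by (simp add: D_def)
  then have "(norm (Y ** transpose Y - Z))\<^sup>2
      = (norm D)\<^sup>2 + 2 * (D \<bullet> (X ** transpose X - Z)) + (norm (X ** transpose X - Z))\<^sup>2"
    by (simp only: power2_norm_eq_inner inner_add_left inner_add_right inner_commute)
  then show ?thesis
    using linear unfolding snmf_objective_def D_def[symmetric] by linarith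
qed

theorem theorem3:
  fixes Z :: "real ^ 'n ^ 'n" and X :: "real ^ 'k ^ 'n"
  assumes "1 \<le> CARD('k)" and "CARD('k) \<le> CARD('n)"
    and "snmf_KKT_point Z X"
    and "pos_semidef (X ** transpose X - (1 / 2) *\<^sub>R (transpose Z + Z))"
  shows "snmf_global_optimum Z X"
proof -
  have "0 \<le> X"
    using assms(3) unfolding snmf_KKT_point_def by blast
  moreover have "snmf_objective Z X \<le> snmf_objective Z Y" for Y :: "real ^ 'k ^ 'n"
    using snmf_objective_diff[of Z Y X] snmf_KKT_point_inner_eq_0[OF assms(3)]
      pos_semidef_inner_matrix_mult_nonneg[OF assms(4), of Y]
      zero_le_power2[of "norm (Y ** transpose Y - X ** transpose X)"]
    by linarith
  ultimately show ?thesis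
    unfolding snmf_global_optimum_def is_arg_min_linorder by blast
qed

end
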